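(* We have $N(H)\gg H^{3/2}$; that is, there is an absolute constant $c>0$ such that $N(H)\ge cH^{3/2}$ for all sufficiently large $H$.
   Context: For a large positive real number $H$, $N(H)$ denotes the number of monic quintic polynomials $f(X)=X^5+aX^4+bX^3+cX^2+dX+e$ with $a,b,c,d,e\in\mathbb{Z}\cap[-H,H]$ that are irreducible (over $\mathbb{Q}$) and solvable by radicals (equivalently, whose Galois group over $\mathbb{Q}$ is solvable). *)

theory Defs
  imports
    Complex_Main
    "HOL-Algebra.Generated_Fields"
    "HOL-Algebra.Algebraic_Closure_Type"
    "HOL-Computational_Algebra.Computational_Algebra"
begin

text \<open>
  The subfields of the complex numbers reached from the rationals by a finite tower of extensions,
  each adjoining one \<open>n\<close>-th root (\<open>n > 0\<close>) of an element of the previous field.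
\<close>

inductive radical_extension :: "complex set \<Rightarrow> bool" where
  base: "radical_extension \<rat>"
| adjoin: "radical_extension K \<Longrightarrow> n > 0 \<Longrightarrow> \<alpha> ^ n \<in> K
    \<Longrightarrow> radical_extension (generate_field (ring_of_type_algebra :: complex ring) (insert \<alpha> K))"

text \<open>
  The splitting field of \<open>p\<close> is taken inside the complex numbers; it lies in the field \<open>K\<close> iff all
  complex roots of \<open>p\<close> do.
\<close>

definition solvable_by_radicals :: "rat poly \<Rightarrow> bool" where
  "solvable_by_radicals p \<longleftrightarrow>
     (\<exists>K. radical_extension K \<and> {z :: complex. poly (map_poly of_rat p) z = 0} \<subseteq> K)"

text \<open>
  Coefficient lists start with the constant term. Irreducibility is imposed over the rationals.
\<close>

definition solvable_quintics :: "real \<Rightarrow> int poly set" where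
  "solvable_quintics H =
     {f. (\<exists>a b c d e. f = [:e, d, c, b, a, 1:] \<and>
            (\<forall>t \<in> {a, b, c, d, e}. real_of_int t \<in> {-H..H})) \<and>
         Factorial_Ring.irreducible (map_poly rat_of_int f) \<and>
         solvable_by_radicals (map_poly rat_of_int f)}"

definition N :: "real \<Rightarrow> nat" where
  "N H = card (solvable_quintics H)"

text \<open>The set being counted is finite, so the cardinality above is not a default value.\<close>

lemma finite_solvable_quintics: "finite (solvable_quintics H)"
proof -
  let ?I = "{-\<lceil>H\<rceil>..\<lceil>H\<rceil>} :: int set"
  let ?g = "\<lambda>(a, b, c, d, e). [:e, d, c, b, a, 1:] :: int poly"
  have box: "t \<in> ?I" if "real_of_int t \<in> {-H..H}" for t
    using that by simp linarith
  have "solvable_quintics H \<subseteq> ?g ` (?I \<times> ?I \<times> ?I \<times> ?I \<times> ?I)"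
  proof
    fix f assume "f \<in> solvable_quintics H"
    then obtain a b c d e where f: "f = [:e, d, c, b, a, 1:]"
      and t: "\<forall>t \<in> {a, b, c, d, e}. real_of_int t \<in> {-H..H}"
      unfolding solvable_quintics_def by blast
    have "(a, b, c, d, e) \<in> ?I \<times> ?I \<times> ?I \<times> ?I \<times> ?I"
      using t box by blast
    then show "f \<in> ?g ` (?I \<times> ?I \<times> ?I \<times> ?I \<times> ?I)"
      unfolding f by (intro image_eqI[where x = "(a, b, c, d, e)"]) auto
  qed
  then show ?thesis
    by (rule finite_subset) blast
qed

end

(*
  The Dickson polynomials X^5 - 5 a X^3 + 5 a^2 X + e are solvable by radicals: substituting
  X = u + v with u v = a turns the equation into u^5 + v^5 = - e, so that u^5 and v^5 are the roots
  of the quadratic W^2 + e W + a^5. If e is congruent to 5 modulo 25, they are irreducible by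
  Eisenstein's criterion at 5. The coefficients are bounded by H as soon as 5 a^2 and |e| are, which
  leaves about H^(1/2) choices for a and about H choices for e.
*)
theory Submission
  imports Defs "Berlekamp_Zassenhaus.Factor_Bound"
begin

text \<open>Take the least index m with p not dividing the m-th coefficient of g. In the m-th
  coefficient of g * h every term except g_m * h_0 is divisible by p, and so is the whole sum, hence
  p divides h_0.\<close>

lemma eisenstein_aux:
  fixes g h :: "int poly"
  assumes p: "prime p"
    and low: "\<And>i. i \<le> Polynomial.degree g \<Longrightarrow> p dvd poly.coeff (g * h) i"
    and lead: "\<not> p dvd lead_coeff g"
  shows "p dvd poly.coeff h 0"
proof (rule ccontr)
  assume h0: "\<not> p dvd poly.coeff h 0"
  define m where "m = (LEAST i. \<not> p dvd poly.coeff g i)"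
  have m: "\<not> p dvd poly.coeff g m"
    unfolding m_def using lead by (rule LeastI)
  have m_le: "m \<le> Polynomial.degree g"
    unfolding m_def using lead by (rule Least_le)
  have below: "p dvd poly.coeff g i" if "i < m" for i
    using not_less_Least that unfolding m_def by blast
  have "poly.coeff (g * h) m = (\<Sum>i<m. poly.coeff g i * poly.coeff h (m - i)) + poly.coeff g m * poly.coeff h 0"
    by (simp add: coeff_mult flip: lessThan_Suc_atMost)
  moreover have "p dvd (\<Sum>i<m. poly.coeff g i * poly.coeff h (m - i))"
    by (intro dvd_sum dvd_mult2 below) simp
  ultimately have "p dvd poly.coeff g m * poly.coeff h 0"
    using low[OF m_le] by (simp add: dvd_add_right_iff)
  with p m h0 show False
    by (simp add: prime_dvd_mult_iff)
qed

text \<open>Both factors have degree below that of f, so \<open>eisenstein_aux\<close> applies to g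
  * h and to h * g. Then p divides both constant terms, and p^2 divides their product.\<close>

lemma eisenstein:
  fixes f :: "int poly"
  assumes p: "prime p" and deg: "Polynomial.degree f > 0"
    and low: "\<And>i. i < Polynomial.degree f \<Longrightarrow> p dvd poly.coeff f i"
    and lead: "\<not> p dvd lead_coeff f"
    and const: "\<not> p\<^sup>2 dvd poly.coeff f 0"
  shows "irreducible\<^sub>d f"
proof (rule irreducible\<^sub>dI[OF deg])
  fix g h :: "int poly"
  assume g: "Polynomial.degree g < Polynomial.degree f"
    and h: "Polynomial.degree h < Polynomial.degree f" and f: "f = g * h"
  have lead': "\<not> p dvd lead_coeff g" "\<not> p dvd lead_coeff h"
    using lead by (auto simp: f lead_coeff_mult)
  have "p dvd poly.coeff h 0"
    using eisenstein_aux[OF p, of g h] low g lead' f by auto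
  moreover have "p dvd poly.coeff g 0"
    using eisenstein_aux[OF p, of h g] low h lead' f by (auto simp: mult.commute)
  ultimately have "p\<^sup>2 dvd poly.coeff f 0"
    by (simp add: f coeff_mult power2_eq_square mult_dvd_mono)
  with const show False ..
qed

text \<open>Gauss's lemma carries the result to the rationals. There nonzero constants are units, so
  having no factorization into smaller degrees means being irreducible.\<close>

lemma eisenstein_rat:
  fixes f :: "int poly"
  assumes "prime p" "Polynomial.degree f > 0"
    "\<And>i. i < Polynomial.degree f \<Longrightarrow> p dvd poly.coeff f i"
    "\<not> p dvd lead_coeff f" "\<not> p\<^sup>2 dvd poly.coeff f 0"
  shows "Factorial_Ring.irreducible (map_poly rat_of_int f)"
  using irreducible\<^sub>d_int_rat[OF eisenstein[OF assms]] by simp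

abbreviation adjoin_root :: "complex \<Rightarrow> complex set \<Rightarrow> complex set" where
  "adjoin_root \<alpha> K \<equiv> generate_field (ring_of_type_algebra :: complex ring) (insert \<alpha> K)"

lemma adjoin_root_incl: "insert \<alpha> K \<subseteq> adjoin_root \<alpha> K"
  by (auto intro: generate_field.incl)

lemma adjoin_root_add: "x \<in> adjoin_root \<alpha> K \<Longrightarrow> y \<in> adjoin_root \<alpha> K \<Longrightarrow> x + y \<in> adjoin_root \<alpha> K"
  using generate_field.eng_add[of x ring_of_type_algebra _ y]
  by (simp add: ring_of_type_algebra_def)

lemma adjoin_root_mult: "x \<in> adjoin_root \<alpha> K \<Longrightarrow> y \<in> adjoin_root \<alpha> K \<Longrightarrow> x * y \<in> adjoin_root \<alpha> K"
  using generate_field.eng_mult[of x ring_of_type_algebra _ y]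
  by (simp add: ring_of_type_algebra_def)

lemma radical_extension_add: "radical_extension K \<Longrightarrow> x \<in> K \<Longrightarrow> y \<in> K \<Longrightarrow> x + y \<in> K"
  by (induction rule: radical_extension.cases) (auto intro: adjoin_root_add)

lemma radical_extension_mult: "radical_extension K \<Longrightarrow> x \<in> K \<Longrightarrow> y \<in> K \<Longrightarrow> x * y \<in> K"
  by (induction rule: radical_extension.cases) (auto intro: adjoin_root_mult)

lemma radical_extension_Rats: "radical_extension K \<Longrightarrow> \<rat> \<subseteq> K"
  by (induction rule: radical_extension.induct) (use adjoin_root_incl in blast)+

lemma radical_extension_diff:
  assumes K: "radical_extension K" and "x \<in> K" "y \<in> K"
  shows "x - y \<in> K"
proof -
  have "(- 1) * y \<in> K"
    using K radical_extension_Rats[OF K] assms(3) by (intro radical_extension_mult) auto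
  then show ?thesis
    using radical_extension_add[OF K assms(2)] by fastforce
qed

lemma radical_extension_power: "radical_extension K \<Longrightarrow> x \<in> K \<Longrightarrow> x ^ n \<in> K"
  by (induction n) (use radical_extension_Rats[of K] in \<open>auto intro: radical_extension_mult\<close>)

text \<open>Adjoining first a primitive n-th root of unity \<zeta> and then a single root r of w
  gives all n-th roots of w, since each has the form \<zeta>^k * r.\<close>

lemma radical_extension_adjoin_roots:
  assumes K: "radical_extension K" and n: "n > 0" and w: "w \<in> K"
  obtains L where "radical_extension L" "K \<subseteq> L" "{z. z ^ n = w} \<subseteq> L"
proof -
  define \<zeta> where "\<zeta> = cis (2 * pi / real n)"
  define K' where "K' = adjoin_root \<zeta> K"
  have \<zeta>: "\<zeta> ^ n = 1"
    using n by (simp add: \<zeta>_def Complex.DeMoivre)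
  then have "\<zeta> ^ n \<in> K"
    using radical_extension_Rats[OF K] by auto
  then have K': "radical_extension K'"
    unfolding K'_def by (rule radical_extension.adjoin[OF K n])
  have K'_incl: "\<zeta> \<in> K'" "K \<subseteq> K'"
    unfolding K'_def using adjoin_root_incl by blast+
  define r where "r = rcis (root n (cmod w)) (Arg w / real n)"
  have r: "r ^ n = w"
    using n by (simp add: r_def DeMoivre2 rcis_cmod_Arg)
  define L where "L = adjoin_root r K'"
  have L: "radical_extension L"
    unfolding L_def using r w K'_incl by (intro radical_extension.adjoin[OF K' n]) auto
  have L_incl: "r \<in> L" "K' \<subseteq> L"
    unfolding L_def using adjoin_root_incl by blast+
  have "z \<in> L" if z: "z ^ n = w" for z
  proof (cases "r = 0")
    \<comment> \<open>Here w = 0, whose only n-th root is 0; the quotient z / r below needs r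
      \<noteq> 0.\<close>
    case True
    then have "z = r"
      using z r n by (metis power_eq_0_iff)
    then show ?thesis
      using L_incl by simp
  next
    case False
    then have "(z / r) ^ n = 1"
      using z r by (auto simp: power_divide)
    then obtain k where "z / r = cis (2 * pi * real k / real n)"
      using bij_betw_roots_unity[OF n] unfolding bij_betw_def by blast
    also have "\<dots> = \<zeta> ^ k"
      by (simp add: \<zeta>_def Complex.DeMoivre mult_ac)
    finally have "z = \<zeta> ^ k * r"
      using False by (simp add: field_simps)
    then show ?thesis
      using L L_incl K'_incl by (auto intro: radical_extension_mult radical_extension_power)
  qed
  then show thesis
    using that[OF L] L_incl K'_incl by blast
qed

text \<open>The tower adjoins the square roots of the discriminant of W^2 + e W + a^5, then all
  fifth roots of one root p of this quadratic, then all fifth roots of the other root q.\<close>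

lemma radical_extension_contains_dickson_roots:
  fixes a e :: complex
  assumes "a \<in> \<rat>" "e \<in> \<rat>"
  obtains K where "radical_extension K" "{z. z ^ 5 - 5 * a * z ^ 3 + 5 * a\<^sup>2 * z + e = 0} \<subseteq> K"
proof -
  define s where "s = csqrt (e\<^sup>2 - 4 * a ^ 5)"
  \<comment> \<open>The factors 1 / 2 and - 1 / 2 are rational, so membership of p and q needs only
    closure under sums, differences and products.\<close>
  define p q where "p = (1 / 2) * (s - e)" and "q = (- 1 / 2) * (s + e)"
  have s: "s\<^sup>2 = e\<^sup>2 - 4 * a ^ 5"
    by (simp add: s_def)
  have "p * q = (e\<^sup>2 - s\<^sup>2) / 4"
    by (simp add: p_def q_def field_simps power2_eq_square)
  then have pq: "p + q = - e" "p * q = a ^ 5"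
    by (simp_all add: s) (simp add: p_def q_def field_simps)
  have "e\<^sup>2 - 4 * a ^ 5 \<in> \<rat>"
    using assms by (intro Rats_diff Rats_mult Rats_power) auto
  then obtain K1 where K1: "radical_extension K1" "{z. z ^ 2 = e\<^sup>2 - 4 * a ^ 5} \<subseteq> K1"
    using radical_extension_adjoin_roots[OF radical_extension.base pos2] by blast
  have "s \<in> K1" "e \<in> K1" "1 / 2 \<in> K1" "- 1 / 2 \<in> K1"
    using K1 s assms radical_extension_Rats[OF K1(1)] by auto
  then have "p \<in> K1" "q \<in> K1"
    unfolding p_def q_def
    by (intro radical_extension_mult[OF K1(1)] radical_extension_diff[OF K1(1)]
        radical_extension_add[OF K1(1)]; simp)+
  obtain K2 where K2: "radical_extension K2" "K1 \<subseteq> K2" "{z. z ^ 5 = p} \<subseteq> K2"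
    using radical_extension_adjoin_roots[OF K1(1) _ \<open>p \<in> K1\<close>, of 5] by auto
  obtain K3 where K3: "radical_extension K3" "K2 \<subseteq> K3" "{z. z ^ 5 = q} \<subseteq> K3"
    using radical_extension_adjoin_roots[OF K2(1), of 5 q] \<open>q \<in> K1\<close> K2(2) by auto
  have fifth_roots: "z \<in> K3" if "z ^ 5 = p \<or> z ^ 5 = q" for z
    using that K2 K3 by auto
  have "z \<in> K3" if z: "z ^ 5 - 5 * a * z ^ 3 + 5 * a\<^sup>2 * z + e = 0" for z
  proof -
    \<comment> \<open>u and v are the roots of T^2 - z T + a. Nothing places t in the tower: u and v
      get there only because their fifth powers turn out to be p and q.\<close>
    define t where "t = csqrt (z\<^sup>2 - 4 * a)"
    define u v where "u = (z + t) / 2" and "v = (z - t) / 2"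
    have "t\<^sup>2 = z\<^sup>2 - 4 * a"
      by (simp add: t_def)
    then have uv: "u * v = a" and z_eq: "z = u + v"
      by (simp_all add: u_def v_def field_simps power2_eq_square)
    have "u ^ 5 + v ^ 5 = z ^ 5 - 5 * a * z ^ 3 + 5 * a\<^sup>2 * z"
      unfolding z_eq uv[symmetric] by (simp add: eval_nat_numeral algebra_simps)
    then have sum5: "u ^ 5 + v ^ 5 = p + q"
      using z by (simp add: pq eq_neg_iff_add_eq_0)
    have prod5: "u ^ 5 * v ^ 5 = p * q"
      using uv pq by (simp flip: power_mult_distrib)
    \<comment> \<open>The pairs u^5, v^5 and p, q have equal sums and products, so they are the
      roots of the same quadratic.\<close>
    have "(u ^ 5 - p) * (u ^ 5 - q) = u ^ 5 * (u ^ 5 - (p + q)) + p * q"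
      by (simp add: algebra_simps)
    also have "\<dots> = 0"
      by (simp add: algebra_simps flip: sum5 prod5)
    finally have "(u ^ 5 = p \<and> v ^ 5 = q) \<or> (u ^ 5 = q \<and> v ^ 5 = p)"
      using sum5 by auto
    then show ?thesis
      unfolding z_eq by (intro radical_extension_add[OF K3(1)] fifth_roots) auto
  qed
  then show thesis
    using that[OF K3(1)] by blast
qed

text \<open>This is D_5(X, a) + e, where the Dickson polynomial D_5 satisfies D_5(u + v, u v) = u^5
  + v^5.\<close>

definition dickson_quintic :: "int \<Rightarrow> int \<Rightarrow> int poly" where
  "dickson_quintic a e = [:e, 5 * a\<^sup>2, 0, - 5 * a, 0, 1:]"

lemma solvable_by_radicals_dickson_quintic:
  "solvable_by_radicals (map_poly rat_of_int (dickson_quintic a e))"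
proof -
  obtain K where K: "radical_extension K"
    "{z :: complex. z ^ 5 - 5 * of_int a * z ^ 3 + 5 * (of_int a)\<^sup>2 * z + of_int e = 0} \<subseteq> K"
    using radical_extension_contains_dickson_roots[of "of_int a" "of_int e"] by auto
  have "poly (map_poly of_rat (map_poly rat_of_int (dickson_quintic a e))) z =
      z ^ 5 - 5 * of_int a * z ^ 3 + 5 * (of_int a)\<^sup>2 * z + of_int e" for z :: complex
    by (simp add: dickson_quintic_def map_poly_pCons of_rat_mult of_rat_power of_rat_minus
        algebra_simps eval_nat_numeral)
  with K show ?thesis
    unfolding solvable_by_radicals_def by auto
qed

lemma irreducible_dickson_quintic:
  assumes "5 dvd e" "\<not> 25 dvd e"
  shows "Factorial_Ring.irreducible (map_poly rat_of_int (dickson_quintic a e))"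
proof (rule eisenstein_rat[where p = 5])
  show "5 dvd poly.coeff (dickson_quintic a e) i" if "i < Polynomial.degree (dickson_quintic a e)" for i
    using that assms
    by (auto simp: dickson_quintic_def coeff_pCons split: nat.split)
qed (use assms in \<open>simp_all add: dickson_quintic_def\<close>)

lemma dickson_quintic_in_solvable_quintics:
  assumes "5 dvd e" "\<not> 25 dvd e" and "real_of_int (5 * a\<^sup>2) \<le> H" "\<bar>real_of_int e\<bar> \<le> H" "1 \<le> H"
  shows "dickson_quintic a e \<in> solvable_quintics H"
proof -
  \<comment> \<open>For integers the bound on 5 a^2 thus also controls the coefficient - 5
    a.\<close>
  have "\<bar>a\<bar> \<le> a\<^sup>2"
    using self_le_power[of "\<bar>a\<bar>" 2] by (cases "a = 0") auto
  then have "real_of_int \<bar>5 * a\<bar> \<le> real_of_int (5 * a\<^sup>2)"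
    by (subst of_int_le_iff) simp
  then have "\<forall>t \<in> {0, - 5 * a, 0, 5 * a\<^sup>2, e}. real_of_int t \<in> {-H..H}"
    using assms(3-5) by auto
  then show ?thesis
    unfolding solvable_quintics_def
    using irreducible_dickson_quintic[OF assms(1,2)] solvable_by_radicals_dickson_quintic
    by (auto simp: dickson_quintic_def)
qed

text \<open>The pairs (a, k) with 5 a^2 \<le> H and 25 k + 5 \<le> H, both entries nonnegative, give
  distinct members of the set. Putting e = 25 k + 5 makes e divisible by 5 but not by 25.\<close>

lemma N_ge:
  assumes H: "H \<ge> 10"
  shows "real (N H) \<ge> sqrt (H / 5) * (H / 50)"
proof -
  define A B where "A = \<lfloor>sqrt (H / 5)\<rfloor>" and "B = \<lfloor>(H - 5) / 25\<rfloor>"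
  let ?f = "\<lambda>(a, k). dickson_quintic a (25 * k + 5)"
  have "0 \<le> A" "0 \<le> B"
    using H by (simp_all add: A_def B_def)
  have A: "real_of_int (5 * a\<^sup>2) \<le> H" if "a \<in> {0..A}" for a
  proof -
    have "real_of_int a \<le> sqrt (H / 5)"
      using that by (simp add: A_def le_floor_iff)
    then have "(real_of_int a)\<^sup>2 \<le> H / 5"
      using that H power_mono[of "real_of_int a" "sqrt (H / 5)" 2] by simp
    then show ?thesis
      by simp
  qed
  have B: "\<bar>real_of_int (25 * k + 5)\<bar> \<le> H" if "k \<in> {0..B}" for k
    using that by (simp add: B_def le_floor_iff)
  \<comment> \<open>The coefficient of X^3 determines a, and the constant term determines k.\<close>
  have "inj_on ?f ({0..A} \<times> {0..B})"
    by (auto simp: inj_on_def dickson_quintic_def)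
  moreover have "?f ` ({0..A} \<times> {0..B}) \<subseteq> solvable_quintics H"
    using A B H by (auto intro!: dickson_quintic_in_solvable_quintics) presburger+
  ultimately have "card ({0..A} \<times> {0..B}) \<le> N H"
    unfolding N_def by (intro card_inj_on_le finite_solvable_quintics)
  then have "real (nat (A + 1)) * real (nat (B + 1)) \<le> real (N H)"
    by (simp add: card_cartesian_product flip: of_nat_mult)
  \<comment> \<open>The ranges start at 0 and so have A + 1 and B + 1 elements, which makes up for
    the rounding down. The assumption H \<ge> 10 then gives (H - 5) / 25 \<ge> H / 50.\<close>
  moreover have "sqrt (H / 5) \<le> real_of_int A + 1" "(H - 5) / 25 \<le> real_of_int B + 1"
    unfolding A_def B_def by linarith+
  then have "sqrt (H / 5) \<le> real (nat (A + 1))" "H / 50 \<le> real (nat (B + 1))"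
    using \<open>0 \<le> A\<close> \<open>0 \<le> B\<close> H by auto
  then have "sqrt (H / 5) * (H / 50) \<le> real (nat (A + 1)) * real (nat (B + 1))"
    using H by (intro mult_mono) auto
  ultimately show ?thesis
    by linarith
qed

theorem corollary1p6:
  shows "\<exists>c::real. c > 0 \<and> (\<forall>\<^sub>F H::real in at_top. real (N H) \<ge> c * H powr (3 / 2))"
proof (intro exI conjI)
  \<comment> \<open>The constant comes from sqrt (H / 5) * (H / 50) = H^(3/2) / (50 * sqrt
    5).\<close>
  show "1 / (50 * sqrt 5) > (0 :: real)"
    by simp
  show "\<forall>\<^sub>F H in at_top. real (N H) \<ge> 1 / (50 * sqrt 5) * H powr (3 / 2)"
    using eventually_ge_at_top[of 10]
  proof eventually_elim
    case (elim H)
    have "H powr (3 / 2) = H powr (1 / 2) * H powr 1"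
      by (subst powr_add[symmetric]) simp
    also have "\<dots> = sqrt H * H"
      using elim by (simp add: powr_half_sqrt)
    finally show ?case
      using N_ge[OF elim] by (simp add: real_sqrt_divide)
  qed
qed

end
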